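(* $\mathrm{SYM}\circ\mathrm{AND}\subseteq k\mathrm{NN}$.
   Context: All classes are classes of families of Boolean functions on $\{0,1\}^n$; "polynomial" means polynomial in $n$. $\mathrm{SYM}\circ\mathrm{AND}$ is the class of functions $f(\mathbf{x})=g(h_1(\mathbf{x}),\dots,h_s(\mathbf{x}))$ where $s$ is polynomial, each $h_i$ is an AND of literals (variables or negated variables) or constants, and $g:\{0,1\}^s\to\{0,1\}$ is symmetric (depends only on the Hamming weight of its input). Let $\Delta(\mathbf{x},\mathbf{y})=\|\mathbf{x}-\mathbf{y}\|_2^2$. A $k$-nearest neighbors representation of $f$ consists of disjoint finite sets $P,N\subseteq\mathbb{R}^n$ (anchors) and a positive integer $k$ such that $f(\mathbf{x})=1$ iff there exists $A\subseteq P\cup N$ with $|A|=k$, $|A\cap P|\ge|A\cap N|$, and $\Delta(\mathbf{x},\mathbf{a})<\Delta(\mathbf{x},\mathbf{b})$ for all $\mathbf{a}\in A$, $\mathbf{b}\notin A$. $k\mathrm{NN}$ is the class of functions having a $k$-nearest neighbors representation (for some positive integer $k$) with polynomially many anchors. *)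

theory Defs
  imports "Jordan_Normal_Form.Matrix" "HOL-Computational_Algebra.Polynomial"
begin

text \<open>The cube \<open>{0,1}\<^sup>n\<close> is \<open>carrier_vec n :: bool vec set\<close> and \<open>\<real>\<^sup>n\<close> is
  \<open>carrier_vec n :: real vec set\<close>. A family \<open>F\<close> has one Boolean function \<open>F n\<close> for every \<open>n\<close>;
  its values outside \<open>carrier_vec n\<close> are never inspected.\<close>

type_synonym bool_fun = "bool vec \<Rightarrow> bool"
type_synonym bool_family = "nat \<Rightarrow> bool_fun"

text \<open>For upper bounds, coefficients in \<open>nat\<close> lose no generality.\<close>

definition poly_bounded :: "(nat \<Rightarrow> nat) \<Rightarrow> bool" where
  "poly_bounded s \<longleftrightarrow> (\<exists>p :: nat poly. \<forall>n. s n \<le> poly p n)"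

definition hamming_weight :: "bool vec \<Rightarrow> nat" where
  "hamming_weight v = card {i. i < dim_vec v \<and> v $ i}"

definition symmetric_fun :: "nat \<Rightarrow> bool_fun \<Rightarrow> bool" where
  "symmetric_fun s g \<longleftrightarrow>
     (\<forall>u \<in> carrier_vec s. \<forall>v \<in> carrier_vec s.
        hamming_weight u = hamming_weight v \<longrightarrow> g u = g v)"

datatype literal = Pos nat | Neg nat

fun literal_index :: "literal \<Rightarrow> nat" where
  "literal_index (Pos i) = i"
| "literal_index (Neg i) = i"

fun literal_holds :: "literal \<Rightarrow> bool vec \<Rightarrow> bool" where
  "literal_holds (Pos i) x \<longleftrightarrow> x $ i"
| "literal_holds (Neg i) x \<longleftrightarrow> \<not> x $ i"

definition and_or_const :: "nat \<Rightarrow> bool_fun \<Rightarrow> bool" where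
  "and_or_const n h \<longleftrightarrow>
     (\<exists>L. (\<forall>l \<in> L. literal_index l < n) \<and>
          (\<forall>x \<in> carrier_vec n. h x \<longleftrightarrow> (\<forall>l \<in> L. literal_holds l x))) \<or>
     (\<exists>c. \<forall>x \<in> carrier_vec n. h x = c)"

definition SYM_AND :: "bool_family set" where
  "SYM_AND = {F. \<exists>s. poly_bounded s \<and>
     (\<forall>n. \<exists>g h. symmetric_fun (s n) g \<and> (\<forall>i < s n. and_or_const n (h i)) \<and>
        (\<forall>x \<in> carrier_vec n. F n x = g (vec (s n) (\<lambda>i. h i x))))}"

definition sq_dist :: "real vec \<Rightarrow> real vec \<Rightarrow> real" where
  "sq_dist x y = (x - y) \<bullet> (x - y)"

definition real_point :: "bool vec \<Rightarrow> real vec" where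
  "real_point x = map_vec of_bool x"

definition kNN_representation ::
  "nat \<Rightarrow> real vec set \<Rightarrow> real vec set \<Rightarrow> nat \<Rightarrow> bool_fun \<Rightarrow> bool" where
  "kNN_representation n P N k f \<longleftrightarrow>
     P \<subseteq> carrier_vec n \<and> N \<subseteq> carrier_vec n \<and> finite P \<and> finite N \<and> P \<inter> N = {} \<and> k > 0 \<and>
     (\<forall>x \<in> carrier_vec n. f x \<longleftrightarrow>
        (\<exists>A \<subseteq> P \<union> N. card A = k \<and> card (A \<inter> P) \<ge> card (A \<inter> N) \<and>
           (\<forall>a \<in> A. \<forall>b \<in> (P \<union> N) - A.
              sq_dist (real_point x) a < sq_dist (real_point x) b)))"

text \<open>Only the number of anchors is bounded; \<open>k\<close> may be any positive integer, depending on \<open>n\<close>.\<close>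

definition kNN :: "bool_family set" where
  "kNN = {F. \<exists>m. poly_bounded m \<and>
     (\<forall>n. \<exists>P N k. kNN_representation n P N k (F n) \<and> card (P \<union> N) \<le> m n)}"

end

theory Submission imports Defs begin

text \<open>A subcube that fixes coordinate \<open>0\<close> has an anchor from which all its points are at the same
  prescribed distance, while all other points of the cube are farther away by at least \<open>1\<close>: free
  coordinates of the anchor are \<open>1/2\<close>, fixed ones are the fixed bits, and coordinate \<open>0\<close> is pushed
  out of the cube to adjust the distance. Splitting each AND along coordinate \<open>0\<close> gives such subcubes.

  Each \<open>h i\<close> receives a positive and a negative anchor at slightly different small distances, so the
  satisfied ones are nearest and cancel. They are followed by \<open>s + 1\<close> pairs of ``clock'' anchors, at
  increasing distances independent of the point. With \<open>k = 2 (s + 1)\<close>, if \<open>t\<close> of the ANDs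
  hold, then exactly the first \<open>s + 1 - t\<close> clock pairs are among the \<open>k\<close> nearest anchors. The labels of
  the clock pairs telescope so that the majority after \<open>s + 1 - t\<close> of them is the value of the
  symmetric function at weight \<open>t\<close>.\<close>

section \<open>Subcubes and their anchors\<close>

lemma sq_dist_sum:
  assumes "x \<in> carrier_vec n" "a \<in> carrier_vec n"
  shows "sq_dist x a = (\<Sum>j<n. (x $ j - a $ j)\<^sup>2)"
  using assms by (auto simp: sq_dist_def scalar_prod_def power2_eq_square lessThan_atLeast0
      intro!: sum.cong)

text \<open>Every literal of a satisfied AND holds at \<open>y\<close>, so it holds at
  \<open>x\<close> exactly when \<open>x\<close> and \<open>y\<close> agree at its index.
  Satisfaction by \<open>y\<close> rules out the constant False; the constant True takes
  \<open>J\<close> empty.\<close>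

lemma and_or_const_subcube:
  assumes h: "and_or_const n h" and y: "y \<in> carrier_vec n" "h y"
  obtains J where "J \<subseteq> {..<n}"
    "\<And>x. x \<in> carrier_vec n \<Longrightarrow> h x \<longleftrightarrow> (\<forall>j\<in>J. x $ j = y $ j)"
proof -
  from h consider
      L where "\<forall>l\<in>L. literal_index l < n" "\<forall>x\<in>carrier_vec n. h x \<longleftrightarrow> (\<forall>l\<in>L. literal_holds l x)"
    | c where "\<forall>x\<in>carrier_vec n. h x = c"
    unfolding and_or_const_def by blast
  then show thesis
  proof cases
    case 1
    have "literal_holds l x \<longleftrightarrow> x $ literal_index l = y $ literal_index l" if "l \<in> L" for l x
    proof -
      have "literal_holds l y" using 1 that y by blast
      then show ?thesis by (cases l) auto
    qed
    then show thesis using 1 by (intro that[of "literal_index ` L"]) auto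
  next
    case 2
    then show thesis using y by (intro that[of "{}"]) auto
  qed
qed

lemma subcube_anchor:
  assumes n: "0 < n" and y: "y \<in> carrier_vec n" and J: "0 \<in> J" "J \<subseteq> {..<n}" and l: "0 \<le> l"
  obtains a where "a \<in> carrier_vec n"
    "\<And>x. x \<in> carrier_vec n \<Longrightarrow> \<forall>j\<in>J. x $ j = y $ j \<Longrightarrow> sq_dist (real_point x) a = real n + l"
    "\<And>x. x \<in> carrier_vec n \<Longrightarrow> \<not> (\<forall>j\<in>J. x $ j = y $ j) \<Longrightarrow> sq_dist (real_point x) a \<ge> real n + l + 1"
proof -
  define K :: real where "K = (\<Sum>j<n. if j \<in> J then 0 else 1/4)"
  have "K \<le> (\<Sum>j<n. 1)" unfolding K_def by (intro sum_mono) auto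
  then have K: "K \<le> real n" by simp
  \<comment> \<open>\<open>K\<close> is the cost of the free coordinates, the same for every point;
    \<rho>^2 supplies the rest of the prescribed squared distance, and \<open>K \<le> real n\<close>
    keeps the radicand nonnegative.\<close>
  define \<rho> where "\<rho> = sqrt (real n + l - K)"
  have \<rho>: "\<rho> \<ge> 0" "\<rho>\<^sup>2 = real n + l - K" using K l by (auto simp: \<rho>_def)
  define a :: "real vec" where
    "a = vec n (\<lambda>j. if j = 0 then (if y $ 0 then 1 + \<rho> else - \<rho>)
                    else if j \<in> J then of_bool (y $ j) else 1/2)"
  have a: "a \<in> carrier_vec n" by (simp add: a_def)
  \<comment> \<open>\<tau> is the cost per coordinate before the anchor is pushed out by \<rho> in
    coordinate 0. The push adds \<rho>^2 on the face of \<open>y\<close> and \<rho>^2 + 2 * \<rho>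
    on the opposite one.\<close>
  define \<tau> :: "bool vec \<Rightarrow> nat \<Rightarrow> real" where
    "\<tau> x j = (if j \<in> J then of_bool (x $ j \<noteq> y $ j) else 1/4)" for x j
  have dist: "sq_dist (real_point x) a =
      real n + l - K + 2 * \<rho> * of_bool (x $ 0 \<noteq> y $ 0) + (\<Sum>j<n. \<tau> x j)"
    if x: "x \<in> carrier_vec n" for x
  proof -
    have "(real_point x $ j - a $ j)\<^sup>2 = 
        \<tau> x j + (if j = 0 then \<rho>\<^sup>2 + 2 * \<rho> * of_bool (x $ 0 \<noteq> y $ 0) else 0)"
      if "j < n" for j
      using that x J by (auto simp: real_point_def a_def \<tau>_def power2_eq_square algebra_simps)
    then have "(\<Sum>j<n. (real_point x $ j - a $ j)\<^sup>2) =
      (\<Sum>j<n. \<tau> x j + (if j = 0 then \<rho>\<^sup>2 + 2 * \<rho> * of_bool (x $ 0 \<noteq> y $ 0) else 0))"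
      by (intro sum.cong) auto
    also have "\<dots> = (\<Sum>j<n. \<tau> x j) + (\<rho>\<^sup>2 + 2 * \<rho> * of_bool (x $ 0 \<noteq> y $ 0))"
      using n by (simp add: sum.distrib sum.delta)
    finally show ?thesis
      using x a by (subst sq_dist_sum[of _ n]) (auto simp: real_point_def \<rho>)
  qed
  show thesis
  proof
    show "a \<in> carrier_vec n" by (rule a)
    fix x :: "bool vec" assume x: "x \<in> carrier_vec n"
    {
      assume eq: "\<forall>j\<in>J. x $ j = y $ j"
      then have "(\<Sum>j<n. \<tau> x j) = K" unfolding K_def \<tau>_def by (intro sum.cong) auto
      then show "sq_dist (real_point x) a = real n + l" using dist[OF x] eq J by simp
    next
      assume "\<not> (\<forall>j\<in>J. x $ j = y $ j)"
      then obtain i where i: "i \<in> J" "x $ i \<noteq> y $ i" by blast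
      \<comment> \<open>The disagreement at \<open>i\<close> alone costs 1 more than on the subcube;
        no other term can shrink.\<close>
      have "K + 1 = (\<Sum>j<n. (if j \<in> J then 0 else 1/4) + (if j = i then 1 else 0))"
        using i J by (auto simp: K_def sum.distrib sum.delta)
      also have "\<dots> \<le> (\<Sum>j<n. \<tau> x j)" unfolding \<tau>_def using i by (intro sum_mono) auto
      finally show "sq_dist (real_point x) a \<ge> real n + l + 1" using dist[OF x] \<rho> by simp
    }
  qed
qed

section \<open>Indexed anchors and uniqueness of the neighbor set\<close>

text \<open>Two strictly separated neighbor sets of the same size coincide, so exhibiting one set
  per point decides the existential in the definition both ways. Counting takes place on indices
  instead of anchors.\<close>

lemma kNN_representation_image:
  fixes \<phi> :: "'q \<Rightarrow> real vec"
  assumes Q: "finite Q" and inj: "inj_on \<phi> Q" and carr: "\<phi> ` Q \<subseteq> carrier_vec n" and k: "k > 0"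
    and near: "\<And>x. x \<in> carrier_vec n \<Longrightarrow> \<exists>A\<subseteq>Q. card A = k \<and>
      (\<forall>a\<in>A. \<forall>b\<in>Q - A. sq_dist (real_point x) (\<phi> a) < sq_dist (real_point x) (\<phi> b)) \<and>
      (f x \<longleftrightarrow> card {a\<in>A. \<not> lab a} \<le> card {a\<in>A. lab a})"
  shows "kNN_representation n (\<phi> ` {q\<in>Q. lab q}) (\<phi> ` {q\<in>Q. \<not> lab q}) k f"
proof -
  let ?P = "\<phi> ` {q\<in>Q. lab q}" and ?N = "\<phi> ` {q\<in>Q. \<not> lab q}"
  have un: "?P \<union> ?N = \<phi> ` Q" by auto
  have "f x \<longleftrightarrow> (\<exists>A \<subseteq> ?P \<union> ?N. card A = k \<and> card (A \<inter> ?P) \<ge> card (A \<inter> ?N) \<and>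
         (\<forall>a \<in> A. \<forall>b \<in> (?P \<union> ?N) - A. sq_dist (real_point x) a < sq_dist (real_point x) b))"
    (is "_ \<longleftrightarrow> (\<exists>A \<subseteq> _. ?C A)") if x: "x \<in> carrier_vec n" for x
  proof -
    from near[OF x] obtain A where A: "A \<subseteq> Q" "card A = k"
      "\<And>a b. a \<in> A \<Longrightarrow> b \<in> Q - A \<Longrightarrow> sq_dist (real_point x) (\<phi> a) < sq_dist (real_point x) (\<phi> b)"
      and f: "f x \<longleftrightarrow> card {a\<in>A. \<not> lab a} \<le> card {a\<in>A. lab a}" by blast
    have "\<phi> ` A \<inter> ?P = \<phi> ` {a\<in>A. lab a}" "\<phi> ` A \<inter> ?N = \<phi> ` {a\<in>A. \<not> lab a}"
      using inj A(1) by (auto simp: inj_on_def)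
    moreover have "card (\<phi> ` B) = card B" if "B \<subseteq> A" for B
      using inj A(1) that by (intro card_image inj_on_subset[OF inj]) auto
    ultimately have cards: "card (\<phi> ` A) = k" "card (\<phi> ` A \<inter> ?P) = card {a\<in>A. lab a}"
      "card (\<phi> ` A \<inter> ?N) = card {a\<in>A. \<not> lab a}"
      using A(2) by auto
    have strict: "\<forall>a \<in> \<phi> ` A. \<forall>b \<in> \<phi> ` Q - \<phi> ` A. sq_dist (real_point x) a < sq_dist (real_point x) b"
      using A by auto
    have unique: "B = \<phi> ` A" if B: "B \<subseteq> \<phi> ` Q" "card B = k"
      "\<forall>a \<in> B. \<forall>b \<in> \<phi> ` Q - B. sq_dist (real_point x) a < sq_dist (real_point x) b" for B
    proof -
      have fin: "finite B" "finite (\<phi> ` A)" using B A Q by (auto intro: finite_subset)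
      \<comment> \<open>If neither set contained the other, some \<open>a\<close> and
        \<open>b\<close> would each be strictly nearer to \<open>x\<close> than the other.\<close>
      have "B \<subseteq> \<phi> ` A \<or> \<phi> ` A \<subseteq> B"
      proof (rule ccontr)
        assume "\<not> ?thesis"
        then obtain a b where "a \<in> B - \<phi> ` A" "b \<in> \<phi> ` A - B" by blast
        moreover have "a \<in> \<phi> ` Q" "b \<in> \<phi> ` Q" using calculation B(1) A(1) by auto
        ultimately show False using B(3) strict by (meson DiffD1 DiffD2 DiffI less_asym)
      qed
      then show ?thesis using fin B(2) cards(1) by (metis card_subset_eq)
    qed
    have sub: "\<phi> ` A \<subseteq> \<phi> ` Q" using A(1) by blast
    show ?thesis
    proof
      assume "f x"
      then show "\<exists>B \<subseteq> ?P \<union> ?N. ?C B"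
        unfolding un using sub cards strict f by (intro exI[of _ "\<phi> ` A"]) auto
    next
      assume "\<exists>B \<subseteq> ?P \<union> ?N. ?C B"
      then obtain B where "B \<subseteq> ?P \<union> ?N" "?C B" by blast
      moreover from this have "B = \<phi> ` A" unfolding un by (intro unique) auto
      ultimately show "f x" using cards f by simp
    qed
  qed
  moreover have "?P \<inter> ?N = {}" using inj by (auto simp: inj_on_def)
  ultimately show ?thesis
    unfolding kNN_representation_def using Q carr k by auto
qed

section \<open>Symmetric functions and telescoping labels\<close>

lemma symmetric_fun_threshold:
  assumes "symmetric_fun s g"
  shows "g (vec s b) = g (vec s (\<lambda>i. i < card {i. i < s \<and> b i}))"
proof -
  let ?t = "card {i. i < s \<and> b i}"
  have "?t \<le> card {..<s}" by (intro card_mono) auto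
  then have "{i. i < s \<and> i < ?t} = {..<?t}" by auto
  then have "hamming_weight (vec s (\<lambda>i. i < ?t)) = ?t"
    unfolding hamming_weight_def by (simp cong: conj_cong)
  moreover have "hamming_weight (vec s b) = ?t"
    unfolding hamming_weight_def by (simp cong: conj_cong)
  ultimately show ?thesis
    using assms unfolding symmetric_fun_def by (metis vec_carrier)
qed

text \<open>The difference of the two counts is the sum over \<open>I\<close> of the steps from
  \<open>E i\<close> to \<open>E (Suc i)\<close>. Indices below \<open>m\<close> outside
  \<open>I\<close> have step 0, so it telescopes to \<open>E m\<close> minus 1, which is nonnegative
  exactly when \<open>E m\<close> holds.\<close>

lemma telescope_majority:
  fixes E :: "nat \<Rightarrow> bool"
  assumes "E 0" and "I \<subseteq> {..<m}" and const: "\<And>i. i < m \<Longrightarrow> i \<notin> I \<Longrightarrow> E (Suc i) = E i"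
  shows "card {i\<in>I. E i} \<le> card {i\<in>I. E (Suc i)} \<longleftrightarrow> E m"
proof -
  have fin: "finite I" using assms(2) finite_subset by blast
  have "int (card {i\<in>I. E (Suc i)}) - int (card {i\<in>I. E i}) =
      (\<Sum>i\<in>I. of_bool (E (Suc i)) - of_bool (E i))"
    using fin by (simp add: sum_subtractf Int_def)
  also have "\<dots> = (\<Sum>i<m. of_bool (E (Suc i)) - of_bool (E i))"
    using assms(2) const by (intro sum.mono_neutral_left) auto
  also have "\<dots> = of_bool (E m) - of_bool (E 0)" by (rule sum_lessThan_telescope)
  finally show ?thesis using \<open>E 0\<close> by (cases "E m") auto
qed

section \<open>The representation in positive dimension\<close>

text \<open>The bound counts \<open>s\<close> ANDs and \<open>s + 1\<close> clock indices, each with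
  two half-cubes and two copies.\<close>

lemma kNN_representation_symmetric_and:
  assumes n: "0 < n" and g: "symmetric_fun s g" and h: "\<And>i. i < s \<Longrightarrow> and_or_const n (h i)"
    and f: "\<And>x. x \<in> carrier_vec n \<Longrightarrow> f x = g (vec s (\<lambda>i. h i x))"
  shows "\<exists>P N k. kNN_representation n P N k f \<and> card (P \<union> N) \<le> 8 * s + 4"
proof -
  define H where "H i x \<longleftrightarrow> (i < s \<longrightarrow> h i x)" for i x
  \<comment> \<open>\<open>(i, b, r)\<close> is the copy number \<open>r\<close> of the anchor for \<open>h i\<close>, or for clock pair \<open>i - s\<close>, on the
    half-cube \<open>x $ 0 = b\<close>\<close>
  define C where "C q x \<longleftrightarrow> (case q of (i, b, r :: bool) \<Rightarrow> H i x \<and> x $ 0 = b)" for q x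
  define U where "U = {..<2 * s + 1} \<times> (UNIV :: bool set) \<times> (UNIV :: bool set)"
  \<comment> \<open>Empty pieces are dropped: an anchor is built around a point of its
    subcube.\<close>
  define Q where "Q = {q \<in> U. \<exists>y\<in>carrier_vec n. C q y}"
  have finU: "finite U" and cardU: "card U = 8 * s + 4"
    by (simp_all add: U_def card_cartesian_product del: UNIV_Times_UNIV)
  have QU: "Q \<subseteq> U" by (auto simp: Q_def)
  have finQ: "finite Q" using finU QU finite_subset by blast
  \<comment> \<open>The numerator orders triples lexicographically and is at most
    \<open>8 * s + 3\<close>, so all levels stay below the gap 1 that separates points outside the
    subcube.\<close>
  define level :: "nat \<times> bool \<times> bool \<Rightarrow> real" where
    "level = (\<lambda>(i, b, r). real (4 * i + 2 * of_bool b + of_bool r) / real (8 * s + 4))"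
  have level: "0 \<le> level q" "level q < 1" if "q \<in> U" for q
    using that by (auto simp: level_def U_def)
  have level_less: "level (i, b, r) < level (i', b', r')" if "i < i'" for i i' b b' r r'
  proof -
    have "4 * i + 2 * of_bool b + of_bool r < 4 * i' + 2 * of_bool b' + (of_bool r' :: nat)"
      using that by (cases b; cases b'; cases r; cases r') auto
    then show ?thesis unfolding level_def prod.case by (intro divide_strict_right_mono) linarith+
  qed
  have level_inj: "q = q'" if "level q = level q'" for q q'
  proof -
    obtain i b r i' b' r' where q: "q = (i, b, r)" "q' = (i', b', r')" by (metis prod_cases3)
    then have "i = i'" using that level_less by (metis less_irrefl linorder_neqE_nat)
    then show ?thesis using that q by (cases b; cases b'; cases r; cases r') (auto simp: level_def)
  qed
  have "\<exists>a. a \<in> carrier_vec n \<and> (\<forall>x\<in>carrier_vec n.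
      (C q x \<longrightarrow> sq_dist (real_point x) a = real n + level q) \<and>
      (\<not> C q x \<longrightarrow> sq_dist (real_point x) a \<ge> real n + 1))" if q: "q \<in> Q" for q
  proof -
    obtain i b r where ibr: "q = (i, b, r)" by (cases q) auto
    from q obtain y where y: "y \<in> carrier_vec n" "C q y" by (auto simp: Q_def)
    then have Hy: "H i y" and y0: "y $ 0 = b" by (auto simp: C_def ibr)
    have "and_or_const n (H i)"
    proof (cases "i < s")
      case True
      then show ?thesis using h[OF True] by (simp add: H_def [abs_def])
    qed (auto simp: H_def and_or_const_def)
    then obtain J where J: "J \<subseteq> {..<n}"
      "\<And>x. x \<in> carrier_vec n \<Longrightarrow> H i x \<longleftrightarrow> (\<forall>j\<in>J. x $ j = y $ j)"
      using and_or_const_subcube y(1) Hy by metis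
    have C: "C q x \<longleftrightarrow> (\<forall>j\<in>insert 0 J. x $ j = y $ j)" if "x \<in> carrier_vec n" for x
      using J(2)[OF that] y0 by (auto simp: C_def ibr)
    have "q \<in> U" using q QU by blast
    note lv = level[OF this]
    have "0 \<in> insert 0 J" "insert 0 J \<subseteq> {..<n}" using J n by auto
    from subcube_anchor[OF n y(1) this lv(1)] obtain a where a: "a \<in> carrier_vec n"
      "\<And>x. x \<in> carrier_vec n \<Longrightarrow> C q x \<Longrightarrow> sq_dist (real_point x) a = real n + level q"
      "\<And>x. x \<in> carrier_vec n \<Longrightarrow> \<not> C q x \<Longrightarrow> sq_dist (real_point x) a \<ge> real n + level q + 1"
      using C by metis
    then show ?thesis using lv by force
  qed
  then obtain \<phi> where \<phi>: "\<And>q. q \<in> Q \<Longrightarrow> \<phi> q \<in> carrier_vec n"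
    and \<phi>_in: "\<And>q x. q \<in> Q \<Longrightarrow> x \<in> carrier_vec n \<Longrightarrow> C q x \<Longrightarrow>
      sq_dist (real_point x) (\<phi> q) = real n + level q"
    and \<phi>_out: "\<And>q x. q \<in> Q \<Longrightarrow> x \<in> carrier_vec n \<Longrightarrow> \<not> C q x \<Longrightarrow>
      sq_dist (real_point x) (\<phi> q) \<ge> real n + 1"
    by metis
  have inj: "inj_on \<phi> Q"
  proof (rule inj_onI)
    fix q q' assume q: "q \<in> Q" "q' \<in> Q" "\<phi> q = \<phi> q'"
    then obtain y where y: "y \<in> carrier_vec n" "C q y" by (auto simp: Q_def)
    have "level q < 1" using q(1) QU level by blast
    \<comment> \<open>The point \<open>y\<close> sees the shared anchor at squared distance below
      \<open>real n + 1\<close>, so it lies in the subcube of \<open>q'\<close> too, and the levels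
      agree.\<close>
    then have "C q' y" using \<phi>_in[OF q(1) y] \<phi>_out[OF q(2) y(1)] q(3) by force
    then show "q = q'"
      using \<phi>_in[OF q(1) y] \<phi>_in[OF q(2) y(1)] q(3) by (intro level_inj) auto
  qed
  \<comment> \<open>\<open>E i\<close> is the verdict wanted when the nearest anchors are those with
    index below \<open>i\<close>, which happens at weight \<open>2 * s + 1 - i\<close>. It is True
    up to \<open>s\<close>, so the two copies for an AND get opposite labels.\<close>
  define E where "E i \<longleftrightarrow> (s < i \<longrightarrow> g (vec s (\<lambda>j. j < 2 * s + 1 - i)))" for i
  define lab where "lab = (\<lambda>(i, b :: bool, r). if r then E (Suc i) else \<not> E i)"
  have "\<exists>A\<subseteq>Q. card A = 2 * (s + 1) \<and>
      (\<forall>a\<in>A. \<forall>b\<in>Q - A. sq_dist (real_point x) (\<phi> a) < sq_dist (real_point x) (\<phi> b)) \<and>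
      (f x \<longleftrightarrow> card {a\<in>A. \<not> lab a} \<le> card {a\<in>A. lab a})" if x: "x \<in> carrier_vec n" for x
  proof -
    define T where "T = {i. i < s \<and> h i x}"
    define t where "t = card T"
    have "t \<le> card {..<s}" unfolding t_def T_def by (intro card_mono) auto
    then have t: "t \<le> s" by simp
    \<comment> \<open>The cutoff leaves \<open>t\<close> satisfied ANDs and \<open>s + 1 - t\<close>
      clock indices, hence \<open>s + 1\<close> indices for every \<open>x\<close>.\<close>
    define m where "m = 2 * s + 1 - t"
    define I where "I = {i. i < m \<and> H i x}"
    have I: "I = T \<union> {s..<m}" using t by (auto simp: I_def T_def H_def m_def)
    have finI: "finite I" by (simp add: I_def)
    have "card I = card T + card {s..<m}" unfolding I by (rule card_Un_disjoint) (auto simp: T_def)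
    also have "\<dots> = s + 1" using t by (simp add: t_def m_def)
    finally have cardI: "card I = s + 1" .
    define A where "A = I \<times> {x $ 0} \<times> (UNIV :: bool set)"
    have AC: "q \<in> A \<longleftrightarrow> fst q < m \<and> C q x" for q
      by (auto simp: A_def I_def C_def split: prod.splits)
    have AQ: "A \<subseteq> Q"
    proof
      fix q assume "q \<in> A"
      then show "q \<in> Q" using x AC[of q] by (auto simp: Q_def U_def m_def mem_Times_iff)
    qed
    have cardA: "card A = 2 * (s + 1)" by (simp add: A_def card_cartesian_product cardI)
    have near: "sq_dist (real_point x) (\<phi> a) < sq_dist (real_point x) (\<phi> b)"
      if a: "a \<in> A" and b: "b \<in> Q - A" for a b
    proof (cases "C b x")
      case True
      then have "fst a < fst b" using a b AC by (meson DiffD2 le_less_trans not_le order.strict_trans1)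
      then have "level a < level b" by (cases a; cases b) (auto intro: level_less)
      moreover have "a \<in> Q" "C a x" "b \<in> Q" using a b AQ AC by blast+
      ultimately show ?thesis using \<phi>_in[of a x] \<phi>_in[of b x] x True by simp
    next
      case False
      have "a \<in> Q" "C a x" "b \<in> Q" using a b AQ AC by blast+
      moreover from this have "level a < 1" using QU level by blast
      ultimately show ?thesis using \<phi>_in[of a x] \<phi>_out[of b x] x False by simp
    qed
    have count: "card {a\<in>A. p (snd (snd a)) (fst a)} = card {i\<in>I. p True i} + card {i\<in>I. p False i}"
      for p :: "bool \<Rightarrow> nat \<Rightarrow> bool"
    proof -
      let ?S = "\<lambda>r. (\<lambda>i. (i, x $ 0, r)) ` {i\<in>I. p r i}"
      have "a \<in> A \<and> p (snd (snd a)) (fst a) \<longleftrightarrow> a \<in> ?S True \<union> ?S False" for a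
      proof -
        obtain i b r where "a = (i, b, r)" by (cases a)
        then show ?thesis by (cases r) (auto simp: A_def)
      qed
      then have "{a\<in>A. p (snd (snd a)) (fst a)} = ?S True \<union> ?S False" by blast
      moreover have "card (?S r) = card {i\<in>I. p r i}" for r
        by (rule card_image) (simp add: inj_on_def)
      moreover have "?S True \<inter> ?S False = {}" by blast
      moreover have "finite (?S r)" for r using finI by simp
      ultimately show ?thesis by (simp only: card_Un_disjoint)
    qed
    have compl: "card {i\<in>I. \<not> p i} = card I - card {i\<in>I. p i}" "card {i\<in>I. p i} \<le> card I" for p
    proof -
      have "{i\<in>I. \<not> p i} = I - {i\<in>I. p i}" by auto
      then show "card {i\<in>I. \<not> p i} = card I - card {i\<in>I. p i}"
        using finI by (simp add: card_Diff_subset)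
      show "card {i\<in>I. p i} \<le> card I" using finI by (intro card_mono) auto
    qed
    have pos: "card {a\<in>A. lab a} = card {i\<in>I. E (Suc i)} + card {i\<in>I. \<not> E i}"
      using count[of "\<lambda>r i. if r then E (Suc i) else \<not> E i"] by (simp add: lab_def case_prod_unfold)
    have neg: "card {a\<in>A. \<not> lab a} = card {i\<in>I. \<not> E (Suc i)} + card {i\<in>I. E i}"
      using count[of "\<lambda>r i. \<not> (if r then E (Suc i) else \<not> E i)"]
      by (simp add: lab_def case_prod_unfold)
    \<comment> \<open>Positive minus negative labels is twice the difference of the two counts on
      the right.\<close>
    have "card {a\<in>A. \<not> lab a} \<le> card {a\<in>A. lab a} \<longleftrightarrow> card {i\<in>I. E i} \<le> card {i\<in>I. E (Suc i)}"
      unfolding pos neg compl(1) using compl(2)[of E] compl(2)[of "\<lambda>i. E (Suc i)"] by linarith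
    \<comment> \<open>The indices below \<open>m\<close> missing from \<open>I\<close> are
      unsatisfied ANDs, where \<open>E\<close> stays True.\<close>
    also have "\<dots> \<longleftrightarrow> E m"
      by (rule telescope_majority) (auto simp: E_def I_def H_def)
    also have "\<dots> \<longleftrightarrow> g (vec s (\<lambda>j. j < t))"
    proof -
      have "s < m" "2 * s + 1 - m = t" using t by (simp_all add: m_def)
      then show ?thesis by (simp only: E_def simp_thms)
    qed
    also have "\<dots> \<longleftrightarrow> f x"
      unfolding f[OF x] symmetric_fun_threshold[OF g, of "\<lambda>i. h i x"] t_def T_def ..
    finally have "f x \<longleftrightarrow> card {a\<in>A. \<not> lab a} \<le> card {a\<in>A. lab a}" by (rule sym)
    then show ?thesis using AQ cardA near by (intro exI[of _ A] conjI ballI)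
  qed
  then have "kNN_representation n (\<phi> ` {q\<in>Q. lab q}) (\<phi> ` {q\<in>Q. \<not> lab q}) (2 * (s + 1)) f"
    using \<phi> by (intro kNN_representation_image finQ inj) (simp_all add: image_subset_iff)
  moreover have "card (\<phi> ` {q\<in>Q. lab q} \<union> \<phi> ` {q\<in>Q. \<not> lab q}) \<le> 8 * s + 4"
  proof -
    have "\<phi> ` {q\<in>Q. lab q} \<union> \<phi> ` {q\<in>Q. \<not> lab q} = \<phi> ` Q" by blast
    then show ?thesis
      using card_image_le[OF finQ, of \<phi>] card_mono[OF finU QU] cardU by simp
  qed
  ultimately show ?thesis by (intro exI conjI)
qed

text \<open>There is no coordinate 0 to split along, but the cube is one point: a single anchor
  labelled by the value there suffices.\<close>

lemma kNN_representation_dim_zero: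
  "\<exists>P N k. kNN_representation 0 P N k f \<and> card (P \<union> N) \<le> 1"
proof -
  let ?\<phi> = "\<lambda>_ :: unit. vNil :: real vec"
  let ?P = "?\<phi> ` {q\<in>{()}. f vNil}" and ?N = "?\<phi> ` {q\<in>{()}. \<not> f vNil}"
  have "kNN_representation 0 ?P ?N 1 f"
  proof (rule kNN_representation_image)
    fix x :: "bool vec" assume "x \<in> carrier_vec 0"
    then have "x = vNil" by auto
    then have "f x \<longleftrightarrow> card {a\<in>{()}. \<not> f vNil} \<le> card {a\<in>{()}. f vNil}"
      by (cases "f vNil") simp_all
    then show "\<exists>A\<subseteq>{()}. card A = 1 \<and>
        (\<forall>a\<in>A. \<forall>b\<in>{()} - A. sq_dist (real_point x) vNil < sq_dist (real_point x) vNil) \<and>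
        (f x \<longleftrightarrow> card {a\<in>A. \<not> f vNil} \<le> card {a\<in>A. f vNil})"
      by (intro exI[of _ "{()}"] conjI) simp_all
  qed simp_all
  moreover have "card (?P \<union> ?N) \<le> 1" by (cases "f vNil") simp_all
  ultimately show ?thesis by (intro exI conjI)
qed

theorem theorem7: "SYM_AND \<subseteq> kNN"
proof
  fix F assume "F \<in> SYM_AND"
  then obtain s where s: "poly_bounded s" and
    F: "\<And>n. \<exists>g h. symmetric_fun (s n) g \<and> (\<forall>i < s n. and_or_const n (h i)) \<and>
        (\<forall>x \<in> carrier_vec n. F n x = g (vec (s n) (\<lambda>i. h i x)))"
    unfolding SYM_AND_def by blast
  from s obtain p where p: "\<And>n. s n \<le> poly p n" unfolding poly_bounded_def by blast
  have "poly_bounded (\<lambda>n. 8 * s n + 4)"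
    unfolding poly_bounded_def using p by (intro exI[of _ "smult 8 p + [:4:]"]) simp
  moreover have "\<exists>P N k. kNN_representation n P N k (F n) \<and> card (P \<union> N) \<le> 8 * s n + 4" for n
  proof (cases "n = 0")
    case True
    obtain P N k where "kNN_representation 0 P N k (F 0)" "card (P \<union> N) \<le> 1"
      using kNN_representation_dim_zero by blast
    then show ?thesis using True by (intro exI[of _ P] exI[of _ N] exI[of _ k]) simp
  next
    case False
    then show ?thesis using F[of n] kNN_representation_symmetric_and[of n "s n"] by blast
  qed
  ultimately show "F \<in> kNN" unfolding kNN_def by blast
qed

end
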